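(* Let $d^{(2)}_{n,4}$ be the number of permutations $\sigma\in S_n$ that have no $1324$-match and satisfy $\mathrm{des}(\sigma)=2$. Then, as formal power series, $$\sum_{n\ge 0}d^{(2)}_{n,4}\frac{t^n}{n!}=e^{3t}+(5-4t)e^{2t}+(t^2-10t+5)e^t-11-4t+\frac{t^3}{6}+\frac{t^4}{24}.$$ Consequently, for all $n\ge 5$, $d^{(2)}_{n,4}=3^n+(5-2n)2^n+n^2-11n+5$.
   Context: For a sequence of distinct integers, $\mathrm{red}$ denotes the permutation obtained by replacing the $i$-th smallest integer of the sequence by $i$. A permutation $\sigma=\sigma_1\cdots\sigma_n\in S_n$ has a $1324$-match if $\mathrm{red}(\sigma_i\sigma_{i+1}\sigma_{i+2}\sigma_{i+3})=1\,3\,2\,4$ for some $i$ (consecutive positions). $\mathrm{des}(\sigma)=|\{i:\sigma_i>\sigma_{i+1}\}|$. *)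

theory Defs
  imports
    "HOL-Computational_Algebra.Formal_Power_Series"
    "HOL-Combinatorics.Multiset_Permutations"
begin

text \<open>
  Permutations in \<open>S\<^sub>n\<close> are given in one-line notation, i.e. as the lists in
  \<^term>\<open>permutations_of_set {1..n}\<close>. List positions are counted from 0.
\<close>

text \<open>An entry is the \<open>i\<close>-th smallest one iff exactly \<open>i\<close> entries are at most as large.\<close>

definition red :: "'a::linorder list \<Rightarrow> nat list" where
  "red xs = map (\<lambda>x. card {y \<in> set xs. y \<le> x}) xs"

definition has_match :: "nat list \<Rightarrow> 'a::linorder list \<Rightarrow> bool" where
  "has_match \<tau> \<sigma> \<longleftrightarrow>
     (\<exists>i. i + length \<tau> \<le> length \<sigma> \<and> red (take (length \<tau>) (drop i \<sigma>)) = \<tau>)"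

definition des :: "'a::linorder list \<Rightarrow> nat" where
  "des \<sigma> = card {i. Suc i < length \<sigma> \<and> \<sigma> ! i > \<sigma> ! Suc i}"

definition d_1324 :: "nat \<Rightarrow> nat \<Rightarrow> nat" where
  "d_1324 k n = card {\<sigma> \<in> permutations_of_set {1..n}. \<not> has_match [1, 3, 2, 4] \<sigma> \<and> des \<sigma> = k}"

end

theory Submission
  imports Defs
begin

text \<open>
  A permutation of \<open>{1..n}\<close> with exactly two descents is a concatenation \<open>A B C\<close> of three increasing
  runs with a descent at both joints. Recording for each value the run that contains it gives a word
  of length \<open>n\<close> over the letters 0, 1, 2, and the word determines the permutation.

  Inside a match of 1324 the middle step is a descent and the outer steps are ascents. A match
  therefore lies astride a joint, and whether one sits at the joint of \<open>A\<close> and \<open>B\<close> depends only on how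
  these two sets of values interleave, that is on the subword of the letters 0 and 1. The joint has
  no descent exactly when this subword is \<open>0\<^sup>a 1\<^sup>b\<close>; it carries a match exactly when the subword is
  \<open>0\<^sup>a 1 0 1\<^sup>b\<close> with \<open>a, b > 0\<close>, for then exchanging the two entries at the joint leaves \<open>A B\<close> increasing.
  Call such subwords near-sorted. The permutations in question correspond to the words for which
  neither the 01-subword nor the 12-subword is near-sorted (\<open>d_1324_eq_card_words\<close>).

  These words are counted by inclusion-exclusion among the \<open>3\<^sup>n\<close> words. A near-sorted word of length
  \<open>k\<close> can be chosen in \<open>(k + 1) + (k - 3)\<close> ways, and the positions of the third letter are free, so each
  single condition is satisfied by \<open>\<Sum>k. (n choose k) ((k + 1) + (k - 3))\<close> words, with \<open>k - 3\<close> truncated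
  at 0. The words satisfying both conditions are those without a letter 1, together with five explicit
  families (\<open>doubly_near_sorted_cases\<close>): one for each combination of the two shapes, and an exceptional
  one in which the displaced 0 and the displaced 2 meet between the same two letters 1. With truncated
  subtraction the resulting formula (\<open>d_1324_2_eq\<close>) is valid for all \<open>n\<close>. It is polynomial-exponential
  from \<open>n = 5\<close> on, and the terms \<open>-11 - 4t + t\<^sup>3/6 + t\<^sup>4/24\<close> of the series correct the values
  for smaller \<open>n\<close>.
\<close>

section \<open>Counting words by their subwords\<close>

definition words :: "'a set \<Rightarrow> nat \<Rightarrow> 'a list set" where
  "words L n = {w. set w \<subseteq> L \<and> length w = n}"

lemma finite_words [simp]: "finite L \<Longrightarrow> finite (words L n)"
  unfolding words_def by (rule finite_lists_length_eq)

lemma card_words: "finite L \<Longrightarrow> card (words L n) = card L ^ n"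
  unfolding words_def by (rule card_lists_length_eq)

lemma card_words_Suc:
  assumes "finite L"
  shows "card {w \<in> words L (Suc n). P w} = (\<Sum>l\<in>L. card {w \<in> words L n. P (l # w)})"
proof -
  have "{w \<in> words L (Suc n). P w} = (\<Union>l\<in>L. (#) l ` {w \<in> words L n. P (l # w)})"
    by (auto simp: words_def length_Suc_conv)
  also have "card \<dots> = (\<Sum>l\<in>L. card ((#) l ` {w \<in> words L n. P (l # w)}))"
    using assms by (intro card_UN_disjoint) auto
  also have "\<dots> = (\<Sum>l\<in>L. card {w \<in> words L n. P (l # w)})"
    by (intro sum.cong refl card_image) auto
  finally show ?thesis .
qed

lemma sum_choose_Suc:
  fixes g :: "nat \<Rightarrow> nat"
  shows "(\<Sum>k\<le>Suc n. (Suc n choose k) * g k) = (\<Sum>k\<le>n. (n choose k) * (g k + g (Suc k)))"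
proof -
  have "(\<Sum>k\<le>Suc n. (Suc n choose k) * g k)
      = g 0 + (\<Sum>k\<le>n. (n choose Suc k) * g (Suc k)) + (\<Sum>k\<le>n. (n choose k) * g (Suc k))"
    by (simp only: sum.atMost_Suc_shift) (simp add: algebra_simps sum.distrib)
  also have "g 0 + (\<Sum>k\<le>n. (n choose Suc k) * g (Suc k)) = (\<Sum>k\<le>Suc n. (n choose k) * g k)"
    by (simp only: sum.atMost_Suc_shift) simp
  finally show ?thesis by (simp add: algebra_simps sum.distrib)
qed

text \<open>
  The left-hand side amounts to choosing the positions that do not carry \<open>z\<close> and then the subword on
  them. Keeping \<open>P\<close> arbitrary lets the induction on \<open>n\<close> absorb the first letter into the predicate,
  after which the claim is Pascal's rule.
\<close>

lemma card_words_filter: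
  assumes "finite L" "z \<notin> L"
  shows "card {w \<in> words (insert z L) n. P (filter (\<lambda>l. l \<noteq> z) w)}
       = (\<Sum>k\<le>n. (n choose k) * card {u \<in> words L k. P u})"
proof (induction n arbitrary: P)
  case 0
  have "{w \<in> words (insert z L) 0. P (filter (\<lambda>l. l \<noteq> z) w)} = {u \<in> words L 0. P u}"
    by (auto simp: words_def)
  then show ?case by simp
next
  case (Suc n)
  let ?g = "\<lambda>P k. card {u \<in> words L k. P u}"
  have "card {w \<in> words (insert z L) (Suc n). P (filter (\<lambda>l. l \<noteq> z) w)}
      = (\<Sum>l\<in>insert z L. card {w \<in> words (insert z L) n. P (filter (\<lambda>l. l \<noteq> z) (l # w))})"
    using assms by (intro card_words_Suc) auto
  also have "\<dots> = card {w \<in> words (insert z L) n. P (filter (\<lambda>l. l \<noteq> z) w)}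
      + (\<Sum>l\<in>L. card {w \<in> words (insert z L) n. P (l # filter (\<lambda>l. l \<noteq> z) w)})"
    using assms by (auto intro!: sum.cong arg_cong[where f = card])
  also have "\<dots> = (\<Sum>k\<le>n. (n choose k) * ?g P k)
      + (\<Sum>l\<in>L. \<Sum>k\<le>n. (n choose k) * ?g (\<lambda>u. P (l # u)) k)"
    using Suc.IH[of P] Suc.IH[of "\<lambda>u. P (l # u)" for l] by simp
  also have "(\<Sum>l\<in>L. \<Sum>k\<le>n. (n choose k) * ?g (\<lambda>u. P (l # u)) k)
      = (\<Sum>k\<le>n. (n choose k) * ?g P (Suc k))"
    unfolding card_words_Suc[OF assms(1)]
    by (subst sum.swap) (simp add: sum_distrib_left)
  also have "(\<Sum>k\<le>n. (n choose k) * ?g P k) + (\<Sum>k\<le>n. (n choose k) * ?g P (Suc k))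
      = (\<Sum>k\<le>Suc n. (Suc n choose k) * ?g P k)"
    unfolding sum_choose_Suc by (simp add: algebra_simps sum.distrib)
  finally show ?case .
qed

lemma card_pairs_sum: "card {(a, b). a + b + j = n} = n + 1 - j" for n j :: nat
proof -
  have "{(a, b). a + b + j = n} = (\<lambda>a. (a, n - j - a)) ` {..<n + 1 - j}"
    by (auto simp: image_iff)
  also have "card \<dots> = n + 1 - j"
    by (subst card_image) (auto simp: inj_on_def)
  finally show ?thesis .
qed

lemma finite_pairs_sum: "finite {(a, b). a + b + j = n}" for n j :: nat
  by (rule finite_subset[of _ "{..n} \<times> {..n}"]) auto

lemma finite_triples_sum: "finite {(a, b, c). a + b + c + j = n}" for n j :: nat
  by (rule finite_subset[of _ "{..n} \<times> {..n} \<times> {..n}"]) auto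

lemma card_triples_sum:
  "card {(a, b, c). a + b + c + j = n} = (n + 2 - j) choose 2" for n j :: nat
proof -
  have *: "card {(a, b, c). a + b + c = m} = (m + 2) choose 2" for m :: nat
  proof (induction m)
    case 0
    have "{(a, b, c). a + b + c = (0::nat)} = {(0, 0, 0)}" by auto
    then show ?case by (simp add: numeral_2_eq_2)
  next
    case (Suc m)
    let ?T = "{(a, b, c). a + b + c = m}"
    have L: "{(a, b, c). a + b + c = Suc m}
        = Pair 0 ` {(b, c). b + c + 0 = Suc m} \<union> (\<lambda>(a, b, c). (Suc a, b, c)) ` ?T"
      (is "?L = ?A \<union> ?B")
    proof (intro equalityI subsetI)
      fix t assume "t \<in> ?L"
      then show "t \<in> ?A \<union> ?B" by (cases t; cases "fst t") (auto simp: image_iff)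
    qed auto
    have "card (?A \<union> ?B) = card ?A + card ?B"
      using finite_pairs_sum[of 0 "Suc m"] finite_triples_sum[of 0 m]
      by (intro card_Un_disjoint) auto
    moreover have "card ?A = card {(b, c). b + c + 0 = Suc m}"
      by (rule card_image) (simp add: inj_on_def)
    moreover have "card {(b, c). b + c + 0 = Suc m} = Suc m + 1 - 0"
      by (rule card_pairs_sum)
    moreover have "card ?B = card ?T"
      by (rule card_image) (auto simp: inj_on_def)
    moreover have "(Suc m + 2) choose 2 = (Suc m + 1 - 0) + ((m + 2) choose 2)"
      by (simp add: numeral_2_eq_2)
    ultimately show ?case
      unfolding L using Suc.IH by linarith
  qed
  show ?thesis
  proof (cases "j \<le> n")
    case True
    then have "{(a, b, c). a + b + c + j = n} = {(a, b, c). a + b + c = n - j}" by auto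
    with True show ?thesis by (simp add: * Suc_diff_le)
  next
    case False
    then have "{(a, b, c). a + b + c + j = n} = {}" by auto
    with False show ?thesis by (simp only: card.empty) (simp add: binomial_eq_0)
  qed
qed

section \<open>Near-sorted words\<close>

text \<open>
  In the second shape the two factors \<open>Suc\<close> matter: without a preceding \<open>x\<close> and a following \<open>y\<close> the
  descent between the two runs is not the middle of a match.
\<close>

definition near_sorted :: "'a \<Rightarrow> 'a \<Rightarrow> 'a list \<Rightarrow> bool" where
  "near_sorted x y u \<longleftrightarrow>
     (\<exists>a b. u = replicate a x @ replicate b y) \<or>
     (\<exists>a b. u = replicate (Suc a) x @ [y, x] @ replicate (Suc b) y)"

lemma card_near_sorted:
  assumes "x \<noteq> y"
  shows "card {u \<in> words {x, y} k. near_sorted x y u} = (k + 1) + (k - 3)"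
proof -
  let ?f = "\<lambda>(a, b). replicate a x @ replicate b y"
  let ?g = "\<lambda>(a, b). replicate (Suc a) x @ [y, x] @ replicate (Suc b) y"
  \<comment> \<open>The numbers of letters \<open>x\<close> and \<open>y\<close> determine the parameters within each shape.\<close>
  have f_inj: "inj_on ?f UNIV"
    using assms by (auto simp: inj_on_def
      dest!: arg_cong[where f = "\<lambda>u. (length (filter ((=) x) u), length (filter ((=) y) u))"])
  have g_inj: "inj_on ?g UNIV"
    using assms by (auto simp: inj_on_def
      dest!: arg_cong[where f = "\<lambda>u. (length (filter ((=) x) u), length (filter ((=) y) u))"])
  let ?A = "{(a, b). a + b + 0 = k}" and ?B = "{(a, b). a + b + 4 = k}"
  have L: "{u \<in> words {x, y} k. near_sorted x y u} = ?f ` ?A \<union> ?g ` ?B"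
    by (auto simp: near_sorted_def words_def image_iff)
  have "card (?f ` ?A \<union> ?g ` ?B) = card (?f ` ?A) + card (?g ` ?B)"
  proof (intro card_Un_disjoint finite_imageI finite_pairs_sum)
    \<comment> \<open>Only in the second shape does an \<open>x\<close> remain after the leading letters \<open>x\<close> are removed.\<close>
    have False if "?f p = ?g q" for p q
    proof -
      have "x \<notin> set (dropWhile (\<lambda>l. l = x) (?f p))"
        using assms by (cases p; cases "snd p") (auto simp: dropWhile_append)
      moreover have "x \<in> set (dropWhile (\<lambda>l. l = x) (?g q))"
        using assms by (cases q) (auto simp: dropWhile_append)
      ultimately show False using that by metis
    qed
    then show "?f ` ?A \<inter> ?g ` ?B = {}" by blast
  qed
  moreover have "card (?f ` ?A) = card ?A"
    by (rule card_image) (rule inj_on_subset[OF f_inj subset_UNIV])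
  moreover have "card (?g ` ?B) = card ?B"
    by (rule card_image) (rule inj_on_subset[OF g_inj subset_UNIV])
  moreover have "card ?A = k + 1 - 0"
    by (rule card_pairs_sum)
  moreover have "card ?B = k + 1 - 4"
    by (rule card_pairs_sum)
  ultimately show ?thesis
    unfolding L by linarith
qed

section \<open>Words that are near-sorted in both pairs of letters\<close>

lemma near_sortedI1: "near_sorted x y (replicate a x @ replicate b y)"
  and near_sortedI2: "near_sorted x y (replicate (Suc a) x @ [y, x] @ replicate (Suc b) y)"
  unfolding near_sorted_def by blast+

definition doubly_near_sorted :: "nat list \<Rightarrow> bool" where
  "doubly_near_sorted w \<longleftrightarrow>
     near_sorted 0 1 (filter (\<lambda>l. l \<noteq> 2) w) \<and> near_sorted 1 2 (filter (\<lambda>l. l \<noteq> 0) w)"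

text \<open>
  The first four families below combine a shape of the 01-subword with a shape of the 12-subword. In
  \<open>crossed_crossed\<close> the value \<open>b = 0\<close> is allowed: the factor \<open>1 0 2 1\<close> then serves both shapes. Among
  the words with a letter 1 this is the only case in which the two subwords do not determine the word:
  the 0 and the 2 may trade places, which gives the family \<open>interleaved\<close>.
\<close>

definition sorted_sorted :: "nat \<times> nat \<times> nat \<Rightarrow> nat list" where
  "sorted_sorted = (\<lambda>(a, b, c). replicate a 0 @ replicate (Suc b) 1 @ replicate c 2)"

definition crossed_sorted :: "nat \<times> nat \<times> nat \<Rightarrow> nat list" where
  "crossed_sorted = (\<lambda>(a, b, c). replicate (Suc a) 0 @ [1, 0] @ replicate (Suc b) 1 @ replicate c 2)"

definition sorted_crossed :: "nat \<times> nat \<times> nat \<Rightarrow> nat list" where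
  "sorted_crossed = (\<lambda>(a, b, c). replicate a 0 @ replicate (Suc b) 1 @ [2, 1] @ replicate (Suc c) 2)"

definition crossed_crossed :: "nat \<times> nat \<times> nat \<Rightarrow> nat list" where
  "crossed_crossed = (\<lambda>(a, b, c).
     replicate (Suc a) 0 @ [1, 0] @ replicate b 1 @ [2, 1] @ replicate (Suc c) 2)"

definition interleaved :: "nat \<times> nat \<Rightarrow> nat list" where
  "interleaved = (\<lambda>(a, c). replicate (Suc a) 0 @ [1, 2, 0, 1] @ replicate (Suc c) 2)"

lemmas family_defs =
  sorted_sorted_def crossed_sorted_def sorted_crossed_def crossed_crossed_def interleaved_def

text \<open>
  Two subwords sharing the letter 1 are read in parallel: while the 12-subword waits at a 1, every
  leading 0 of the 01-subword is forced to be a leading letter of the word.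
\<close>

lemma peel_zeros:
  assumes "set w \<subseteq> {0, 1, 2}"
    and "filter (\<lambda>l. l \<noteq> 2) w = replicate a 0 @ u" "filter (\<lambda>l. l \<noteq> 0) w = 1 # v"
  shows "\<exists>w'. w = replicate a (0::nat) @ w' \<and> filter (\<lambda>l. l \<noteq> 2) w' = u \<and>
              filter (\<lambda>l. l \<noteq> 0) w' = 1 # v"
  using assms
proof (induction a arbitrary: w)
  case (Suc a)
  from Suc.prems obtain w1 where w: "w = 0 # w1"
    by (cases w) (auto split: if_splits)
  with Suc.prems Suc.IH[of w1] show ?case by auto
qed auto

lemma filter_nonzero_eq:
  assumes "filter (\<lambda>l. l \<noteq> 2) w = u" "(0::nat) \<notin> set u"
  shows "filter (\<lambda>l. l \<noteq> 0) w = w"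
proof -
  have "0 \<notin> set w" using assms by auto
  then show ?thesis by (intro filter_True) metis
qed

lemma near_sorted_Cons_cases:
  assumes "near_sorted x y t" "x \<in> set t" "x \<noteq> y"
  shows "\<exists>v. t = x # v \<and> ((\<exists>b c. v = replicate b x @ replicate c y) \<or>
                        (\<exists>b c. v = replicate b x @ [y, x] @ replicate (Suc c) y))"
proof -
  from assms(1) consider (sorted) a b where "t = replicate a x @ replicate b y"
    | (crossed) a b where "t = replicate (Suc a) x @ [y, x] @ replicate (Suc b) y"
    unfolding near_sorted_def by blast
  then show ?thesis
  proof cases
    case sorted
    with assms obtain a' where "a = Suc a'" by (cases a) auto
    with sorted show ?thesis by auto
  next
    case crossed
    then show ?thesis by auto
  qed
qed

text \<open>
  A letter 1 makes the 12-subword start with 1, so the zeros of a sorted 01-subword can be peeled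
  off, and what remains is the 12-subword itself. If the 01-subword is crossed, peeling stops at
  the factor \<open>1 0\<close>. The only freedom is then whether a letter 2 comes before the displaced 0, which
  needs a 12-subword with a single 1 in front of its displaced 2.
\<close>

lemma doubly_near_sorted_cases:
  assumes "set w \<subseteq> {0, 1, 2}" "1 \<in> set w" "doubly_near_sorted w"
  shows "w \<in> range sorted_sorted \<union> range crossed_sorted \<union> range sorted_crossed
          \<union> range crossed_crossed \<union> range interleaved"
proof -
  obtain v where v: "filter (\<lambda>l. l \<noteq> 0) w = 1 # v"
    and v_cases: "(\<exists>b c. v = replicate b 1 @ replicate c 2) \<or>
                  (\<exists>b c. v = replicate b 1 @ [2, 1] @ replicate (Suc c) 2)"
  proof -
    have "near_sorted 1 2 (filter (\<lambda>l. l \<noteq> 0) w)" "1 \<in> set (filter (\<lambda>l. l \<noteq> 0) w)"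
      using assms(2,3) by (simp_all add: doubly_near_sorted_def)
    from near_sorted_Cons_cases[OF this] that show thesis by (metis numeral_One num.distinct(1) numeral_eq_iff)
  qed
  from assms(3) consider
      (sorted) a b where "filter (\<lambda>l. l \<noteq> 2) w = replicate a 0 @ replicate b 1"
    | (crossed) a b where
        "filter (\<lambda>l. l \<noteq> 2) w = replicate (Suc a) 0 @ [1, 0] @ replicate (Suc b) 1"
    unfolding doubly_near_sorted_def near_sorted_def by blast
  then show ?thesis
  proof cases
    case sorted
    from peel_zeros[OF assms(1) sorted v] obtain w' where w': "w = replicate a 0 @ w'"
      "filter (\<lambda>l. l \<noteq> 2) w' = replicate b 1" "filter (\<lambda>l. l \<noteq> 0) w' = 1 # v" by blast
    have "w' = 1 # v" using filter_nonzero_eq[OF w'(2)] w'(3) by simp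
    with w'(1) v_cases show ?thesis
    proof (elim disjE exE)
      fix b c assume "v = replicate b 1 @ replicate c 2"
      with \<open>w' = 1 # v\<close> w'(1) have "w = sorted_sorted (a, b, c)" by (simp add: family_defs)
      then show ?thesis by blast
    next
      fix b c assume "v = replicate b 1 @ [2, 1] @ replicate (Suc c) 2"
      with \<open>w' = 1 # v\<close> w'(1) have "w = sorted_crossed (a, b, c)" by (simp add: family_defs)
      then show ?thesis by blast
    qed
  next
    case crossed
    from peel_zeros[OF assms(1) crossed v] obtain w1 where w1: "w = replicate (Suc a) 0 @ w1"
      "filter (\<lambda>l. l \<noteq> 2) w1 = [1, 0] @ replicate (Suc b) 1" "filter (\<lambda>l. l \<noteq> 0) w1 = 1 # v"
      by blast
    from w1(2,3) obtain w2 where w2: "w1 = 1 # w2"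
      "filter (\<lambda>l. l \<noteq> 2) w2 = 0 # replicate (Suc b) 1" "filter (\<lambda>l. l \<noteq> 0) w2 = v"
      by (cases w1) (auto split: if_splits)
    \<comment> \<open>Both subwords contain the same letters 1; this matches their parameters.\<close>
    have "filter (\<lambda>l. l = 1) (filter (\<lambda>l. l \<noteq> 0) w2) = filter (\<lambda>l. l = 1) (filter (\<lambda>l. l \<noteq> 2) w2)"
      unfolding filter_filter by (rule filter_cong) auto
    with w2(2,3) have ones: "length (filter (\<lambda>l. l = 1) v) = Suc b" by simp
    from w2(2) consider (zero) x where "w2 = 0 # x" | (two) x where "w2 = 2 # x"
      by (cases w2) (auto split: if_splits)
    then show ?thesis
    proof cases
      case zero
      have "x = v"
        using filter_nonzero_eq[of x "replicate (Suc b) 1"] w2 zero by simp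
      with v_cases show ?thesis
      proof (elim disjE exE)
        fix b' c assume v': "v = replicate b' 1 @ replicate c 2"
        with ones have "b' = Suc b" by simp
        with v' \<open>x = v\<close> zero w2 w1 have "w = crossed_sorted (a, b, c)" by (simp add: family_defs)
        then show ?thesis by blast
      next
        fix b' c assume v': "v = replicate b' 1 @ [2, 1] @ replicate (Suc c) 2"
        with \<open>x = v\<close> zero w2 w1 have "w = crossed_crossed (a, b', c)" by (simp add: family_defs)
        then show ?thesis by blast
      qed
    next
      case two
      with w2 have x: "filter (\<lambda>l. l \<noteq> 2) x = 0 # replicate (Suc b) 1"
        "v = 2 # filter (\<lambda>l. l \<noteq> 0) x" by auto
      from v_cases show ?thesis
      proof (elim disjE exE)
        fix b' c assume v': "v = replicate b' 1 @ replicate c 2"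
        with ones have "b' = Suc b" by simp
        with v' x show ?thesis by simp
      next
        fix b' c assume v': "v = replicate b' 1 @ [2, 1] @ replicate (Suc c) 2"
        with x(2) have "filter (\<lambda>l. l \<noteq> 0) x = 1 # replicate (Suc c) 2"
          by (cases b') auto
        moreover from x(1) this obtain y where "x = 0 # y" "filter (\<lambda>l. l \<noteq> 2) y = replicate (Suc b) 1"
          by (cases x) (auto split: if_splits)
        ultimately have "x = 0 # 1 # replicate (Suc c) 2"
          using filter_nonzero_eq[of y "replicate (Suc b) 1"] by simp
        with two w2 w1 have "w = interleaved (a, c)" by (simp add: family_defs)
        then show ?thesis by blast
      qed
    qed
  qed
qed

lemma doubly_near_sorted_families:
  "doubly_near_sorted (sorted_sorted (a, b, c))"
  "doubly_near_sorted (crossed_sorted (a, b, c))"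
  "doubly_near_sorted (sorted_crossed (a, b, c))"
  "doubly_near_sorted (crossed_crossed (a, b, c))"
  "doubly_near_sorted (interleaved (a, c))"
  using near_sortedI1[of "0::nat" 1 a "Suc b"] near_sortedI1[of 1 "2::nat" "Suc b" c]
    near_sortedI2[of "0::nat" 1 a b] near_sortedI1[of 1 "2::nat" "Suc (Suc b)" c]
    near_sortedI1[of "0::nat" 1 a "Suc (Suc b)"] near_sortedI2[of 1 "2::nat" b c]
    near_sortedI2[of "0::nat" 1 a 0] near_sortedI2[of 1 "2::nat" 0 c]
  by (simp_all add: doubly_near_sorted_def family_defs replicate_append_same)

lemma families_in_words:
  "sorted_sorted (a, b, c) \<in> words {0, 1, 2} n \<longleftrightarrow> a + b + c + 1 = n"
  "crossed_sorted (a, b, c) \<in> words {0, 1, 2} n \<longleftrightarrow> a + b + c + 4 = n"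
  "sorted_crossed (a, b, c) \<in> words {0, 1, 2} n \<longleftrightarrow> a + b + c + 4 = n"
  "crossed_crossed (a, b, c) \<in> words {0, 1, 2} n \<longleftrightarrow> a + b + c + 6 = n"
  "interleaved (a, c) \<in> words {0, 1, 2} n \<longleftrightarrow> a + c + 6 = n"
  by (auto simp: family_defs words_def)

lemma one_in_families:
  "1 \<in> set (sorted_sorted (a, b, c))" "1 \<in> set (crossed_sorted (a, b, c))" "1 \<in> set (sorted_crossed (a, b, c))"
  "1 \<in> set (crossed_crossed (a, b, c))" "1 \<in> set (interleaved (a, c))"
  by (simp_all add: family_defs)

text \<open>
  Sortedness of the three two-letter subwords separates the five families.
\<close>

lemma sorted_families:
  "sorted (filter (\<lambda>l. l \<noteq> 2) (sorted_sorted t))" "sorted (filter (\<lambda>l. l \<noteq> 0) (sorted_sorted t))"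
  "\<not> sorted (filter (\<lambda>l. l \<noteq> 2) (crossed_sorted t))" "sorted (filter (\<lambda>l. l \<noteq> 0) (crossed_sorted t))"
  "sorted (filter (\<lambda>l. l \<noteq> 2) (sorted_crossed t))" "\<not> sorted (filter (\<lambda>l. l \<noteq> 0) (sorted_crossed t))"
  "\<not> sorted (filter (\<lambda>l. l \<noteq> 2) (crossed_crossed t))" "\<not> sorted (filter (\<lambda>l. l \<noteq> 0) (crossed_crossed t))"
  "\<not> sorted (filter (\<lambda>l. l \<noteq> 2) (interleaved s))" "\<not> sorted (filter (\<lambda>l. l \<noteq> 0) (interleaved s))"
  "sorted (filter (\<lambda>l. l \<noteq> 1) (crossed_crossed t))" "\<not> sorted (filter (\<lambda>l. l \<noteq> 1) (interleaved s))"
  by (auto simp: family_defs sorted_append split: prod.splits)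

lemma inj_families: "inj sorted_sorted" "inj crossed_sorted" "inj sorted_crossed" "inj crossed_crossed" "inj interleaved"
  unfolding family_defs
  by (auto simp: inj_def dest!: arg_cong[where f = "\<lambda>w. (length (filter (\<lambda>l. l = 0) w),
    length (filter (\<lambda>l. l = 1) w), length (filter (\<lambda>l. l = 2) w))"])

lemma card_doubly_near_sorted:
  "card {w \<in> words {0, 1, 2} n. doubly_near_sorted w}
     = 2 ^ n + ((n + 1) choose 2) + 2 * ((n - 2) choose 2) + ((n - 4) choose 2) + (n - 5)"
proof -
  let ?T = "\<lambda>j. {(a, b, c). a + b + c + j = n}" and ?P = "{(a, c). a + c + 6 = n}"
  let ?D = "{w \<in> words {0, 1, 2} n. doubly_near_sorted w}"
  define U SS MS SM MM X where
    "U = words {0, 2::nat} n" and "SS = sorted_sorted ` ?T 1" and "MS = crossed_sorted ` ?T 4"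
    and "SM = sorted_crossed ` ?T 4" and "MM = crossed_crossed ` ?T 6" and "X = interleaved ` ?P"
  note defs = U_def SS_def MS_def SM_def MM_def X_def
  have "?D = U \<union> (SS \<union> (MS \<union> (SM \<union> (MM \<union> X))))"
  proof (intro equalityI subsetI)
    fix w assume w: "w \<in> ?D"
    show "w \<in> U \<union> (SS \<union> (MS \<union> (SM \<union> (MM \<union> X))))"
    proof (cases "1 \<in> set w")
      case True
      with w doubly_near_sorted_cases[of w] have
        "w \<in> range sorted_sorted \<union> range crossed_sorted \<union> range sorted_crossed
          \<union> range crossed_crossed \<union> range interleaved"
        by (simp add: words_def)
      moreover from w have "w \<in> words {0, 1, 2} n" by simp
      ultimately show ?thesis by (auto simp: defs families_in_words simp del: One_nat_def)
    next
      case False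
      with w show ?thesis by (auto simp: U_def words_def)
    qed
  next
    fix w assume "w \<in> U \<union> (SS \<union> (MS \<union> (SM \<union> (MM \<union> X))))"
    then consider "w \<in> U" | "w \<in> SS \<union> (MS \<union> (SM \<union> (MM \<union> X)))" by blast
    then show "w \<in> ?D"
    proof cases
      case 1
      then have sub: "set w \<subseteq> {0, 2}" and len: "length w = n" by (auto simp: U_def words_def)
      have "filter (\<lambda>l. l \<noteq> 2) w = replicate (length (filter (\<lambda>l. l \<noteq> 2) w)) 0"
        "filter (\<lambda>l. l \<noteq> 0) w = replicate (length (filter (\<lambda>l. l \<noteq> 0) w)) 2"
        using sub by (auto simp: list_eq_iff_nth_eq dest!: nth_mem)
      with near_sortedI1[of 0 1 _ 0] near_sortedI1[of 1 2 0] have "doubly_near_sorted w"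
        unfolding doubly_near_sorted_def by (metis append.left_neutral append.right_neutral replicate_0)
      with sub len show ?thesis by (auto simp: words_def)
    next
      case 2
      then show ?thesis
        by (auto simp: defs families_in_words doubly_near_sorted_families simp del: One_nat_def)
    qed
  qed
  moreover have "finite U" "finite SS" "finite MS" "finite SM" "finite MM" "finite X"
    unfolding defs by (intro finite_imageI finite_triples_sum finite_pairs_sum finite_words; simp)+
  moreover have "U \<inter> (SS \<union> (MS \<union> (SM \<union> (MM \<union> X)))) = {}"
  proof -
    have "1 \<notin> set w" if "w \<in> U" for w
      using that by (auto simp: U_def words_def)
    moreover have "1 \<in> set w" if "w \<in> SS \<union> (MS \<union> (SM \<union> (MM \<union> X)))" for w
      using that by (auto simp: defs one_in_families simp del: One_nat_def)
    ultimately show ?thesis by blast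
  qed
  moreover have "SS \<inter> (MS \<union> (SM \<union> (MM \<union> X))) = {}" "MS \<inter> (SM \<union> (MM \<union> X)) = {}"
    "SM \<inter> (MM \<union> X) = {}" "MM \<inter> X = {}"
    unfolding defs using sorted_families by (safe; metis)+
  ultimately have "card ?D = card U + (card SS + (card MS + (card SM + (card MM + card X))))"
    by (simp add: card_Un_disjoint)
  moreover have "card U = 2 ^ n"
    unfolding U_def by (subst card_words) (auto simp: numeral_2_eq_2)
  moreover have "card SS = card (?T 1)" "card MS = card (?T 4)" "card SM = card (?T 4)"
    "card MM = card (?T 6)" "card X = card ?P"
    unfolding defs by (rule card_image, rule inj_on_subset[OF _ subset_UNIV], rule inj_families)+
  moreover have "card (?T 1) = (n + 2 - 1) choose 2" "card (?T 4) = (n + 2 - 4) choose 2"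
    "card (?T 6) = (n + 2 - 6) choose 2" "card ?P = n + 1 - 6"
    by (rule card_triples_sum card_pairs_sum)+
  ultimately show ?thesis by simp
qed

section \<open>Increasing runs, descents and matches\<close>

definition descents :: "'a::linorder list \<Rightarrow> nat set" where
  "descents xs = {i. Suc i < length xs \<and> xs ! i > xs ! Suc i}"

definition descends :: "'a::linorder list \<Rightarrow> 'a list \<Rightarrow> bool" where
  "descends X Y \<longleftrightarrow> X \<noteq> [] \<and> Y \<noteq> [] \<and> hd Y < last X"

text \<open>
  For adjacent increasing runs \<open>X\<close> and \<open>Y\<close> this is a 1324-match in the middle of which the joint lies.
\<close>

definition crosses :: "'a::linorder list \<Rightarrow> 'a list \<Rightarrow> bool" where
  "crosses X Y \<longleftrightarrow> (\<exists>X' x1 x2 y1 y2 Y'.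
     X = X' @ [x1, x2] \<and> Y = [y1, y2] @ Y' \<and> x1 < y1 \<and> y1 < x2 \<and> x2 < y2)"

lemma red_eq_1324_iff: "red [a, b, c, d] = [1, 3, 2, 4] \<longleftrightarrow> a < c \<and> c < b \<and> b < d"
proof
  let ?n = "\<lambda>x. card {y \<in> {a, b, c, d}. y \<le> x}"
  assume "red [a, b, c, d] = [1, 3, 2, 4]"
  then have n: "?n a = 1" "?n b = 3" "?n c = 2" "?n d = 4" by (simp_all add: red_def)
  \<comment> \<open>Ranks are monotone, so comparing ranks compares entries.\<close>
  have "x < x'" if "?n x < ?n x'" for x x'
  proof (rule ccontr)
    assume "\<not> x < x'"
    then have "?n x' \<le> ?n x" by (intro card_mono) auto
    with that show False by simp
  qed
  from this[of a c] this[of c b] this[of b d] n show "a < c \<and> c < b \<and> b < d" by simp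
next
  assume *: "a < c \<and> c < b \<and> b < d"
  then have "{y \<in> {a, b, c, d}. y \<le> a} = {a}" "{y \<in> {a, b, c, d}. y \<le> b} = {a, b, c}"
    "{y \<in> {a, b, c, d}. y \<le> c} = {a, c}" "{y \<in> {a, b, c, d}. y \<le> d} = {a, b, c, d}"
    by auto
  with * show "red [a, b, c, d] = [1, 3, 2, 4]"
    by (auto simp: red_def card_insert_if)
qed

lemma has_match_1324_iff_pos:
  "has_match [1, 3, 2, 4] s \<longleftrightarrow> (\<exists>i. i + 4 \<le> length s \<and> red (take 4 (drop i s)) = [1, 3, 2, 4])"
proof -
  have "length [1, 3, 2, 4::nat] = 4" by simp
  then show ?thesis unfolding has_match_def by presburger
qed

lemma has_match_1324_iff:
  "has_match [1, 3, 2, 4] s \<longleftrightarrow>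
     (\<exists>P x1 x2 y1 y2 Q. s = P @ [x1, x2, y1, y2] @ Q \<and> x1 < y1 \<and> y1 < x2 \<and> x2 < y2)"
proof
  assume "has_match [1, 3, 2, 4] s"
  then obtain i where i: "i + 4 \<le> length s" "red (take 4 (drop i s)) = [1, 3, 2, 4]"
    unfolding has_match_1324_iff_pos by blast
  define t where "t = take 4 (drop i s)"
  with i have "length t = 4" by simp
  then obtain a b c d where "t = [a, b, c, d]"
    by (auto simp: numeral_eq_Suc length_Suc_conv)
  then have t: "take 4 (drop i s) = [a, b, c, d]" by (simp add: t_def)
  have s: "s = take i s @ take 4 (drop i s) @ drop 4 (drop i s)"
    by (metis append_take_drop_id)
  then show "\<exists>P x1 x2 y1 y2 Q. s = P @ [x1, x2, y1, y2] @ Q \<and> x1 < y1 \<and> y1 < x2 \<and> x2 < y2"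
    using i(2) unfolding t red_eq_1324_iff by blast
next
  assume "\<exists>P x1 x2 y1 y2 Q. s = P @ [x1, x2, y1, y2] @ Q \<and> x1 < y1 \<and> y1 < x2 \<and> x2 < y2"
  then obtain P x1 x2 y1 y2 Q where s: "s = P @ [x1, x2, y1, y2] @ Q"
    "x1 < y1" "y1 < x2" "x2 < y2" by blast
  then have "red (take 4 (drop (length P) s)) = [1, 3, 2, 4]"
    using red_eq_1324_iff[of x1 x2 y1 y2] by simp
  moreover have "length P + 4 \<le> length s" using s by simp
  ultimately show "has_match [1, 3, 2, 4] s"
    unfolding has_match_1324_iff_pos by blast
qed

lemma descents_append:
  "i \<in> descents (xs @ ys) \<longleftrightarrow>
     i \<in> descents xs \<or> (descends xs ys \<and> Suc i = length xs) \<or>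
     (length xs \<le> i \<and> i - length xs \<in> descents ys)"
proof -
  consider "Suc i < length xs" | "Suc i = length xs" | "length xs \<le> i" by linarith
  then show ?thesis
  proof cases
    case 1
    then show ?thesis by (auto simp: descents_def nth_append)
  next
    case 2
    then have "last xs = xs ! i" "xs \<noteq> []"
      by (metis diff_Suc_1 last_conv_nth length_0_conv nat.distinct(1))+
    moreover have "(xs @ ys) ! i = xs ! i" "(xs @ ys) ! Suc i = hd ys" if "ys \<noteq> []"
      using 2 that by (simp_all add: nth_append hd_conv_nth)
    ultimately show ?thesis using 2
      by (cases "ys = []") (auto simp: descents_def descends_def)
  next
    case 3
    then show ?thesis by (auto simp: descents_def descends_def nth_append Suc_diff_le)
  qed
qed

lemma descents_sorted:
  assumes "sorted_wrt (<) xs"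
  shows "descents xs = {}"
proof -
  have "xs ! i < xs ! Suc i" if "Suc i < length xs" for i
    using sorted_wrt_nth_less[OF assms, of i "Suc i"] that by simp
  then show ?thesis by (force simp: descents_def)
qed

lemma sorted_if_no_descents:
  assumes "distinct xs" "descents xs = {}"
  shows "sorted_wrt (<) xs"
proof -
  have "xs ! i < xs ! Suc i" if "Suc i < length xs" for i
  proof -
    have "\<not> xs ! i > xs ! Suc i" using assms(2) that by (auto simp: descents_def)
    moreover have "xs ! i \<noteq> xs ! Suc i"
      using nth_eq_iff_index_eq[OF assms(1), of i "Suc i"] that by simp
    ultimately show ?thesis by simp
  qed
  then show ?thesis by (simp add: sorted_wrt_iff_nth_Suc_transp)
qed

lemma descents_three_runs:
  assumes "sorted_wrt (<) A" "sorted_wrt (<) B" "sorted_wrt (<) C" "descends A B" "descends B C"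
  shows "descents (A @ B @ C) = {length A - 1, length A + length B - 1}"
proof (rule set_eqI)
  fix i
  have len: "length A > 0" "length B > 0" using assms(4,5) by (simp_all add: descends_def)
  have "descends A (B @ C)" using assms(4) by (simp add: descends_def)
  with assms have "i \<in> descents (A @ B @ C) \<longleftrightarrow>
      Suc i = length A \<or> (length A \<le> i \<and> Suc (i - length A) = length B)"
    by (simp add: descents_append descents_sorted)
  also have "\<dots> \<longleftrightarrow> i = length A - 1 \<or> i = length A + length B - 1"
    using len by arith
  finally show "i \<in> descents (A @ B @ C) \<longleftrightarrow> i \<in> {length A - 1, length A + length B - 1}"
    by simp
qed

text \<open>
  The middle step of a match is a descent, hence lies at a joint. That the match fits into the two
  runs adjacent to the joint is only in question if \<open>B\<close> is a single entry; but then the neighbouring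
  step is a descent too, while the outer steps of a match are ascents.
\<close>

lemma match_three_runs:
  assumes "sorted_wrt (<) A" "sorted_wrt (<) B" "sorted_wrt (<) C" "descends A B" "descends B C"
  shows "has_match [1, 3, 2, 4] (A @ B @ C) \<longleftrightarrow> crosses A B \<or> crosses B C"
proof
  assume "has_match [1, 3, 2, 4] (A @ B @ C)"
  then obtain P x1 x2 y1 y2 Q where s: "A @ B @ C = P @ [x1, x2, y1, y2] @ Q"
    and less: "x1 < y1" "y1 < x2" "x2 < y2"
    unfolding has_match_1324_iff by blast
  have "Suc (length P) \<in> descents (A @ B @ C)"
    unfolding s using less by (auto simp: descents_def nth_append)
  with descents_three_runs[OF assms] consider
    "length A = length (P @ [x1, x2])" | "length (A @ B) = length (P @ [x1, x2])"
    using assms(4,5) by (auto simp: descends_def)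
  then show "crosses A B \<or> crosses B C"
  proof cases
    case 1
    from s have "A @ (B @ C) = (P @ [x1, x2]) @ ([y1, y2] @ Q)" by simp
    with 1 have A: "A = P @ [x1, x2]" and BC: "B @ C = [y1, y2] @ Q"
      using append_eq_append_conv by blast+
    from BC assms(4) obtain B' where B: "B = y1 # B'" "B' @ C = y2 # Q"
      by (cases B) (auto simp: descends_def)
    then obtain B'' where "B' = y2 # B''"
      using assms(5) less by (cases B') (auto simp: descends_def)
    with A B less show ?thesis unfolding crosses_def by auto
  next
    case 2
    from s have "(A @ B) @ C = (P @ [x1, x2]) @ ([y1, y2] @ Q)" by simp
    with 2 have AB: "A @ B = P @ [x1, x2]" and C: "C = [y1, y2] @ Q"
      using append_eq_append_conv by blast+
    from AB assms(4) obtain B' where B: "B = B' @ [x2]" "A @ B' = P @ [x1]"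
      by (cases B rule: rev_cases) (auto simp: descends_def)
    then obtain B'' where "B' = B'' @ [x1]"
      using assms(4) less by (cases B' rule: rev_cases) (auto simp: descends_def)
    with C B less show ?thesis unfolding crosses_def by auto
  qed
next
  assume "crosses A B \<or> crosses B C"
  then show "has_match [1, 3, 2, 4] (A @ B @ C)"
  proof
    assume "crosses A B"
    then obtain P x1 x2 y1 y2 Q where "A = P @ [x1, x2]" "B = [y1, y2] @ Q"
      and "x1 < y1" "y1 < x2" "x2 < y2" unfolding crosses_def by blast
    moreover from this have "A @ B @ C = P @ [x1, x2, y1, y2] @ (Q @ C)" by simp
    ultimately show ?thesis unfolding has_match_1324_iff by blast
  next
    assume "crosses B C"
    then obtain P x1 x2 y1 y2 Q where "B = P @ [x1, x2]" "C = [y1, y2] @ Q"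
      and "x1 < y1" "y1 < x2" "x2 < y2" unfolding crosses_def by blast
    moreover from this have "A @ B @ C = (A @ P) @ [x1, x2, y1, y2] @ Q" by simp
    ultimately show ?thesis unfolding has_match_1324_iff by blast
  qed
qed

lemma three_runs_exist:
  assumes "distinct s" "card (descents s) = 2"
  obtains A B C where "s = A @ B @ C" "sorted_wrt (<) A" "sorted_wrt (<) B" "sorted_wrt (<) C"
    "descends A B" "descends B C"
proof -
  obtain p q where pq: "descents s = {p, q}" "p < q"
  proof -
    from assms(2) obtain p q where "descents s = {p, q}" "p \<noteq> q" by (auto simp: card_2_iff)
    then show thesis using that[of p q] that[of q p] by (cases p q rule: linorder_cases) auto
  qed
  define A B C where "A = take (Suc p) s" and "B = drop (Suc p) (take (Suc q) s)"
    and "C = drop (Suc q) s"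
  have q: "Suc q < length s" and desc: "s ! p > s ! Suc p" "s ! q > s ! Suc q"
    using pq by (auto simp: descents_def)
  have s: "s = A @ B @ C" unfolding A_def B_def C_def using pq(2)
    by (metis append.assoc append_take_drop_id less_imp_le_nat min_absorb1 Suc_le_mono take_take)
  have len: "length A = Suc p" "length B = q - p" "length C = length s - Suc q"
    using q pq(2) by (simp_all add: A_def B_def C_def)
  have D: "descents (A @ B @ C) = {p, q}" using pq(1) s by simp
  have "descents A = {}"
  proof -
    have "i \<in> {p, q}" if "i \<in> descents A" for i
      using descents_append[of i A "B @ C"] that D by blast
    moreover have "i < p" if "i \<in> descents A" for i
      using that len by (simp add: descents_def)
    ultimately show ?thesis using pq(2) by force
  qed
  moreover have "descents B = {}"
  proof -
    have "i + Suc p \<in> {p, q}" if "i \<in> descents B" for i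
      using descents_append[of "i + Suc p" A "B @ C"] descents_append[of i B C] that D len(1)
      by simp
    moreover have "i + Suc p < q" if "i \<in> descents B" for i
      using that len unfolding descents_def by auto
    ultimately show ?thesis by force
  qed
  moreover have "descents C = {}"
  proof -
    have "i + Suc q \<in> {p, q}" if "i \<in> descents C" for i
    proof -
      have "i + Suc q - length A = i + (q - p)" "length A \<le> i + Suc q"
        using len(1) pq(2) by simp_all
      then show ?thesis
        using descents_append[of "i + Suc q" A "B @ C"] descents_append[of "i + (q - p)" B C]
          that D len(2) by (metis add_diff_cancel_right' le_add2)
    qed
    then show ?thesis using pq(2) by force
  qed
  moreover have "distinct A" "distinct B" "distinct C" using assms(1) s by auto
  moreover have "descends A B" "descends B C"
  proof -
    have "last A = s ! p" "last B = s ! q" "hd C = s ! Suc q"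
      using q pq(2)
      by (simp_all add: A_def B_def C_def take_Suc_conv_app_nth last_drop hd_drop_conv_nth)
    moreover have "hd B = s ! Suc p"
      using q pq(2) by (simp add: B_def hd_drop_conv_nth)
    moreover have "A \<noteq> []" "B \<noteq> []" "C \<noteq> []"
      using len q pq(2) by (simp_all flip: length_greater_0_conv)
    ultimately show "descends A B" "descends B C" using desc by (simp_all add: descends_def)
  qed
  ultimately show thesis using that s sorted_if_no_descents by blast
qed

section \<open>Permutations with two descents as words\<close>

lemma sorted_wrt_less_append_iff:
  fixes A B :: "'a::linorder list"
  assumes "sorted_wrt (<) A" "sorted_wrt (<) B" "set A \<inter> set B = {}"
  shows "sorted_wrt (<) (A @ B) \<longleftrightarrow> \<not> descends A B"
proof (cases "A = [] \<or> B = []")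
  case True
  with assms show ?thesis by (auto simp: descends_def)
next
  case False
  then have in_set: "last A \<in> set A" "hd B \<in> set B" by auto
  have "a \<le> last A" if "a \<in> set A" for a
    using that assms(1) False by (cases A rule: rev_cases) (auto simp: sorted_wrt_append)
  moreover have "hd B \<le> b" if "b \<in> set B" for b
    using that assms(2) False by (cases B) auto
  moreover have "last A \<noteq> hd B" using in_set assms(3) by auto
  ultimately have "(\<forall>a\<in>set A. \<forall>b\<in>set B. a < b) \<longleftrightarrow> \<not> hd B < last A"
    using in_set by (metis linorder_less_linear order.asym order.strict_trans1 order.strict_trans2)
  with False assms(1,2) show ?thesis by (simp add: sorted_wrt_append descends_def)
qed

lemma map_eq_replicate_iff:
  "map f xs = replicate n x \<longleftrightarrow> n = length xs \<and> (\<forall>i\<in>set xs. f i = x)"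
  "replicate n x = map f xs \<longleftrightarrow> n = length xs \<and> (\<forall>i\<in>set xs. f i = x)"
  by (auto simp: list_eq_iff_nth_eq all_set_conv_all_nth)

text \<open>
  The runs can be read off from the shape of the word. Conversely \<open>S\<close>, as the only strictly sorted list
  of these values, is \<open>A @ B\<close> if there is no descent at the joint, and \<open>A @ B\<close> with the two entries at
  the joint exchanged if there is a match.
\<close>

lemma near_sorted_iff_joint:
  assumes "sorted_wrt (<) S" "x \<noteq> y" "\<forall>i\<in>set S. f i = x \<or> f i = y"
    and A: "A = filter (\<lambda>i. f i = x) S" and B: "B = filter (\<lambda>i. f i = y) S"
  shows "near_sorted x y (map f S) \<longleftrightarrow> \<not> descends A B \<or> crosses A B"
proof -
  have AB: "sorted_wrt (<) A" "sorted_wrt (<) B" "set A \<inter> set B = {}" "set A \<union> set B = set S"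
    using assms by (auto simp: sorted_wrt_filter)
  have fA: "\<forall>i\<in>set A. f i = x" and fB: "\<forall>i\<in>set B. f i = y" by (auto simp: A B)
  have "(\<exists>a b. map f S = replicate a x @ replicate b y) \<longleftrightarrow> \<not> descends A B"
  proof
    assume "\<exists>a b. map f S = replicate a x @ replicate b y"
    then obtain S1 S2 where S: "S = S1 @ S2" "\<forall>i\<in>set S1. f i = x" "\<forall>i\<in>set S2. f i = y"
      by (auto simp: map_eq_append_conv map_eq_replicate_iff)
    with assms(2) have "A = S1" "B = S2"
      by (auto simp: A B filter_empty_conv intro!: filter_True)
    with S(1) assms(1) AB show "\<not> descends A B" by (simp flip: sorted_wrt_less_append_iff)
  next
    assume "\<not> descends A B"
    then have "sorted_wrt (<) (A @ B)" using sorted_wrt_less_append_iff AB by blast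
    then have "S = A @ B" using assms(1) AB(4) by (intro strict_sorted_equal) auto
    moreover have "map f A = replicate (length A) x" "map f B = replicate (length B) y"
      using fA fB by (auto simp: map_eq_replicate_iff)
    ultimately show "\<exists>a b. map f S = replicate a x @ replicate b y" by (metis map_append)
  qed
  moreover have "(\<exists>a b. map f S = replicate (Suc a) x @ [y, x] @ replicate (Suc b) y) \<longleftrightarrow> crosses A B"
  proof
    assume "\<exists>a b. map f S = replicate (Suc a) x @ [y, x] @ replicate (Suc b) y"
    then obtain a b where "map f S = replicate a x @ [x, y, x, y] @ replicate b y"
      by (auto simp: replicate_app_Cons_same)
    then obtain S1 i1 i2 i3 i4 S2 where S: "S = S1 @ [i1, i2, i3, i4] @ S2"
      and f: "\<forall>i\<in>set S1. f i = x" "f i1 = x" "f i2 = y" "f i3 = x" "f i4 = y" "\<forall>i\<in>set S2. f i = y"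
      by (auto simp: map_eq_append_conv map_eq_Cons_conv Cons_eq_map_conv map_eq_replicate_iff)
    with assms(2) have "A = S1 @ [i1, i3]" "B = [i2, i4] @ S2"
      by (auto simp: A B filter_empty_conv intro!: filter_True)
    moreover have "i1 < i2" "i2 < i3" "i3 < i4"
      using assms(1) by (simp_all add: S sorted_wrt_append)
    ultimately show "crosses A B" unfolding crosses_def by blast
  next
    assume "crosses A B"
    then obtain A' x1 x2 y1 y2 B' where A': "A = A' @ [x1, x2]" and B': "B = [y1, y2] @ B'"
      and less: "x1 < y1" "y1 < x2" "x2 < y2"
      unfolding crosses_def by blast
    have "sorted_wrt (<) (A' @ [x1, y1, x2, y2] @ B')"
      using AB(1,2) less unfolding A' B' by (force simp: sorted_wrt_append)
    then have "S = A' @ [x1, y1, x2, y2] @ B'"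
      using assms(1) AB(4) unfolding A' B' by (intro strict_sorted_equal) auto
    moreover have "map f A' = replicate (length A') x" "map f B' = replicate (length B') y"
      "f x1 = x" "f x2 = x" "f y1 = y" "f y2 = y"
      using fA fB unfolding A' B' by (auto simp: map_eq_replicate_iff)
    ultimately have "map f S = replicate (Suc (length A')) x @ [y, x] @ replicate (Suc (length B')) y"
      by (simp add: replicate_app_Cons_same)
    then show "\<exists>a b. map f S = replicate (Suc a) x @ [y, x] @ replicate (Suc b) y" by blast
  qed
  ultimately show ?thesis unfolding near_sorted_def by blast
qed

text \<open>
  Positions are counted from 1 because they are the values of a permutation of \<open>{1..n}\<close>.
\<close>

definition positions :: "'a list \<Rightarrow> 'a \<Rightarrow> nat list" where
  "positions w l = filter (\<lambda>i. w ! (i - 1) = l) [1..<Suc (length w)]"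

lemma sorted_positions: "sorted_wrt (<) (positions w l)"
  unfolding positions_def by (intro sorted_wrt_filter sorted_wrt_upt)

lemma set_positions: "set (positions w l) = {i \<in> {1..length w}. w ! (i - 1) = l}"
  by (auto simp: positions_def)

lemma near_sorted_positions_iff:
  assumes "x \<noteq> y" "\<forall>l\<in>set w. l \<noteq> z \<longleftrightarrow> l = x \<or> l = y"
  shows "near_sorted x y (filter (\<lambda>l. l \<noteq> z) w) \<longleftrightarrow>
           \<not> descends (positions w x) (positions w y) \<or> crosses (positions w x) (positions w y)"
proof -
  let ?f = "\<lambda>i. w ! (i - 1)" and ?I = "[1..<Suc (length w)]"
  let ?S = "filter (\<lambda>i. ?f i \<noteq> z) ?I"
  have "map ?f ?I = w" by (intro nth_equalityI) (auto simp del: upt_Suc)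
  then have S: "filter (\<lambda>l. l \<noteq> z) w = map ?f ?S"
    using filter_map[of "\<lambda>l. l \<noteq> z" ?f ?I] by (simp add: comp_def)
  have letters: "?f i \<noteq> z \<longleftrightarrow> ?f i = x \<or> ?f i = y" if "i \<in> set ?I" for i
    using that assms(2) by (auto simp: nth_mem)
  have "positions w x = filter (\<lambda>i. ?f i = x) ?S" "positions w y = filter (\<lambda>i. ?f i = y) ?S"
    unfolding positions_def filter_filter using letters by (intro filter_cong refl; blast)+
  moreover have "sorted_wrt (<) ?S" by (intro sorted_wrt_filter sorted_wrt_upt)
  ultimately show ?thesis
    unfolding S using letters assms(1) by (intro near_sorted_iff_joint) auto
qed

definition perm_of_word :: "nat list \<Rightarrow> nat list" where
  "perm_of_word w = positions w 0 @ positions w 1 @ positions w 2"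

lemma perm_of_word_permutation:
  assumes "w \<in> words {0, 1, 2} n"
  shows "perm_of_word w \<in> permutations_of_set {1..n}"
proof -
  have "w ! (i - 1) \<in> {0, 1, 2}" if "i \<in> {1..n}" for i
  proof -
    have "w ! (i - 1) \<in> set w" using that assms by (intro nth_mem) (auto simp: words_def)
    then show ?thesis using assms by (auto simp: words_def)
  qed
  moreover have "set (perm_of_word w) = {i \<in> {1..n}. w ! (i - 1) \<in> {0, 1, 2}}"
    using assms by (auto simp: perm_of_word_def set_positions words_def)
  ultimately have "set (perm_of_word w) = {1..n}" by blast
  moreover have "distinct (perm_of_word w)"
    by (auto simp: perm_of_word_def set_positions positions_def)
  ultimately show ?thesis by (simp add: permutations_of_set_def)
qed

text \<open>
  With a descent at both joints the descents of the permutation reveal the lengths of its runs,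
  hence the runs, hence the word.
\<close>

lemma perm_of_word_inj:
  assumes "w \<in> words {0, 1, 2} n" "w' \<in> words {0, 1, 2} n"
    and "descends (positions w 0) (positions w 1)" "descends (positions w 1) (positions w 2)"
    and "descends (positions w' 0) (positions w' 1)" "descends (positions w' 1) (positions w' 2)"
    and "perm_of_word w = perm_of_word w'"
  shows "w = w'"
proof -
  have arith: "a = c \<and> b = d" if "{a - 1, a + b - 1} = {c - 1, c + d - 1}" "a > 0" "b > 0" "c > 0" "d > 0"
    for a b c d :: nat
    using that by (auto simp: doubleton_eq_iff)
  have "{length (positions w 0) - 1, length (positions w 0) + length (positions w 1) - 1}
      = {length (positions w' 0) - 1, length (positions w' 0) + length (positions w' 1) - 1}"
    using descents_three_runs[OF sorted_positions sorted_positions sorted_positions assms(3,4)]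
      descents_three_runs[OF sorted_positions sorted_positions sorted_positions assms(5,6)] assms(7)
    by (simp add: perm_of_word_def)
  moreover have "length (positions w 0) > 0" "length (positions w 1) > 0"
    "length (positions w' 0) > 0" "length (positions w' 1) > 0"
    using assms(3-6) by (simp_all add: descends_def)
  ultimately have "length (positions w 0) = length (positions w' 0)" "length (positions w 1) = length (positions w' 1)"
    using arith by blast+
  with assms(7) have blocks: "positions w l = positions w' l" if "l \<in> {0, 1, 2}" for l
    using that by (auto simp: perm_of_word_def)
  show ?thesis
  proof (rule nth_equalityI)
    show "length w = length w'" using assms(1,2) by (simp add: words_def)
    fix i assume i: "i < length w"
    then have "w ! i \<in> {0, 1, 2}" using assms(1) nth_mem by (fastforce simp: words_def)
    from blocks[OF this] have "positions w (w ! i) = positions w' (w ! i)" .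
    moreover have "Suc i \<in> set (positions w (w ! i))" using i by (simp add: set_positions)
    ultimately have "Suc i \<in> set (positions w' (w ! i))" by simp
    then show "w ! i = w' ! i" by (simp add: set_positions)
  qed
qed

lemma perm_of_word_surj:
  assumes "s \<in> permutations_of_set {1..n}" "des s = 2"
  shows "\<exists>w \<in> words {0, 1, 2} n. s = perm_of_word w \<and>
           descends (positions w 0) (positions w 1) \<and> descends (positions w 1) (positions w 2)"
proof -
  from assms have s: "distinct s" "set s = {1..n}" "card (descents s) = 2"
    by (auto simp: permutations_of_set_def des_def descents_def)
  obtain A B C where ABC: "s = A @ B @ C" "sorted_wrt (<) A" "sorted_wrt (<) B" "sorted_wrt (<) C"
    "descends A B" "descends B C" using three_runs_exist[OF s(1,3)] .
  define g where "g i = (if i \<in> set A then 0 else if i \<in> set B then 1 else 2 :: nat)" for i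
  define w where "w = map g [1..<Suc n]"
  have nth: "w ! (i - 1) = g i" if "i \<in> {1..n}" for i
    using that by (auto simp: w_def simp del: upt_Suc)
  have len: "length w = n" by (simp add: w_def)
  have setb: "set (positions w l) = {i \<in> {1..n}. g i = l}" for l
    using nth by (auto simp: set_positions len)
  have sub: "set A \<subseteq> {1..n}" "set B \<subseteq> {1..n}" "set C \<subseteq> {1..n}"
    and un: "set A \<union> set B \<union> set C = {1..n}"
    and disj: "set A \<inter> set B = {}" "set A \<inter> set C = {}" "set B \<inter> set C = {}"
    using s(1,2) by (auto simp: ABC(1))
  have "set (positions w 0) = set A" "set (positions w 1) = set B"
    using sub disj by (auto simp: setb g_def)
  moreover have "set (positions w 2) = set C"
    using sub disj un unfolding setb g_def by auto
  ultimately have blocks: "positions w 0 = A" "positions w 1 = B" "positions w 2 = C"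
    using strict_sorted_equal[OF sorted_positions ABC(2), of w 0]
      strict_sorted_equal[OF sorted_positions ABC(3), of w 1]
      strict_sorted_equal[OF sorted_positions ABC(4), of w 2] by auto
  have "w \<in> words {0, 1, 2} n" by (auto simp: words_def w_def g_def)
  with blocks ABC show ?thesis by (auto simp: perm_of_word_def intro!: bexI[of _ w])
qed

lemma d_1324_eq_card_words:
  "d_1324 2 n = card {w \<in> words {0, 1, 2 :: nat} n.
     \<not> near_sorted 0 1 (filter (\<lambda>l. l \<noteq> 2) w) \<and> \<not> near_sorted 1 2 (filter (\<lambda>l. l \<noteq> 0) w)}"
    (is "_ = card ?W")
proof -
  have W: "w \<in> ?W \<longleftrightarrow> w \<in> words {0, 1, 2} n
      \<and> descends (positions w 0) (positions w 1) \<and> descends (positions w 1) (positions w 2)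
      \<and> \<not> crosses (positions w 0) (positions w 1) \<and> \<not> crosses (positions w 1) (positions w 2)" for w
  proof (cases "w \<in> words {0, 1, 2} n")
    case True
    then have sub: "set w \<subseteq> {0, 1, 2}" by (simp add: words_def)
    have "near_sorted 0 1 (filter (\<lambda>l. l \<noteq> 2) w) \<longleftrightarrow>
        \<not> descends (positions w 0) (positions w 1) \<or> crosses (positions w 0) (positions w 1)"
      using sub by (intro near_sorted_positions_iff) auto
    moreover have "near_sorted 1 2 (filter (\<lambda>l. l \<noteq> 0) w) \<longleftrightarrow>
        \<not> descends (positions w 1) (positions w 2) \<or> crosses (positions w 1) (positions w 2)"
      using sub by (intro near_sorted_positions_iff) auto
    ultimately show ?thesis using True by blast
  qed blast
  have inj: "inj_on perm_of_word ?W"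
    using W perm_of_word_inj by (intro inj_onI) blast
  have image: "perm_of_word ` ?W = {s \<in> permutations_of_set {1..n}. \<not> has_match [1, 3, 2, 4] s \<and> des s = 2}"
    (is "_ = ?S")
  proof (intro equalityI subsetI)
    fix s assume "s \<in> perm_of_word ` ?W"
    then obtain w where w: "s = perm_of_word w" "w \<in> words {0, 1, 2} n"
      and d: "descends (positions w 0) (positions w 1)" "descends (positions w 1) (positions w 2)"
      and nc: "\<not> crosses (positions w 0) (positions w 1)" "\<not> crosses (positions w 1) (positions w 2)"
      using W by blast
    have "length (positions w 0) > 0" "length (positions w 1) > 0" using d by (auto simp: descends_def)
    then have "length (positions w 0) - 1 \<noteq> length (positions w 0) + length (positions w 1) - 1" by arith
    then have "des s = 2"
      using descents_three_runs[OF sorted_positions sorted_positions sorted_positions d]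
      unfolding w(1) perm_of_word_def des_def descents_def[symmetric] by simp
    moreover have "\<not> has_match [1, 3, 2, 4] s"
      using match_three_runs[OF sorted_positions sorted_positions sorted_positions d] nc
      by (simp add: w(1) perm_of_word_def)
    ultimately show "s \<in> ?S" using perm_of_word_permutation w by blast
  next
    fix s assume s: "s \<in> ?S"
    then obtain w where w: "w \<in> words {0, 1, 2} n" "s = perm_of_word w"
      and d: "descends (positions w 0) (positions w 1)" "descends (positions w 1) (positions w 2)"
      using perm_of_word_surj[of s n] by blast
    moreover from s have "\<not> crosses (positions w 0) (positions w 1)" "\<not> crosses (positions w 1) (positions w 2)"
      using match_three_runs[OF sorted_positions sorted_positions sorted_positions d]
      by (simp_all add: w(2) perm_of_word_def)
    ultimately show "s \<in> perm_of_word ` ?W" using W by blast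
  qed
  show ?thesis
    unfolding d_1324_def image[symmetric] by (rule card_image[OF inj])
qed

section \<open>Inclusion-exclusion\<close>

lemma sum_choose_near_sorted:
  "int (\<Sum>k\<le>n. (n choose k) * ((k + 1) + (k - 3)))
     = int n * 2 ^ n - 2 * 2 ^ n + 3 + 2 * int n + int (n choose 2)"
proof -
  \<comment> \<open>The corrections at \<open>k < 3\<close> come from the truncation of \<open>k - 3\<close>.\<close>
  have "int ((k + 1) + (k - 3)) = 2 * int k - 2 + 3 * of_bool (k = 0) + 2 * of_bool (k = 1) + of_bool (k = 2)"
    for k by (cases "k < 3") (auto simp: less_Suc_eq numeral_3_eq_3)
  then have "int (\<Sum>k\<le>n. (n choose k) * ((k + 1) + (k - 3)))
      = (\<Sum>k\<le>n. int (n choose k) * (2 * int k - 2 + 3 * of_bool (k = 0) + 2 * of_bool (k = 1) + of_bool (k = 2)))"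
    by (simp only: of_nat_sum of_nat_mult)
  also have "\<dots> = 2 * (\<Sum>k\<le>n. int k * int (n choose k)) - 2 * (\<Sum>k\<le>n. int (n choose k))
      + 3 * (\<Sum>k\<le>n. int (n choose k) * of_bool (k = 0))
      + 2 * (\<Sum>k\<le>n. int (n choose k) * of_bool (k = 1))
      + (\<Sum>k\<le>n. int (n choose k) * of_bool (k = 2))"
    by (simp only: distrib_left right_diff_distrib sum.distrib sum_subtractf sum_distrib_left mult_ac)
  also have "\<dots> = 2 * int (n * 2 ^ (n - 1)) - 2 * 2 ^ n
      + 3 * int (n choose 0) + 2 * int (n choose 1) + int (n choose 2)"
  proof -
    have "(\<Sum>k\<le>n. int (n choose k) * of_bool (k = j)) = int (n choose j)" for j
      by (simp add: of_bool_def if_distrib sum.delta cong: if_cong)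
    moreover have "(\<Sum>k\<le>n. int k * int (n choose k)) = int (n * 2 ^ (n - 1))"
      unfolding choose_linear_sum[symmetric] by simp
    moreover have "(\<Sum>k\<le>n. int (n choose k)) = 2 ^ n"
      using choose_row_sum[of n] by (simp flip: of_nat_sum)
    ultimately show ?thesis by (simp only:)
  qed
  also have "2 * int (n * 2 ^ (n - 1)) = int n * 2 ^ n"
    by (cases n) (auto simp: algebra_simps)
  finally show ?thesis by simp
qed

lemma card_words_neither_near_sorted:
  "int (card {w \<in> words {0, 1, 2 :: nat} n.
     \<not> near_sorted 0 1 (filter (\<lambda>l. l \<noteq> 2) w) \<and> \<not> near_sorted 1 2 (filter (\<lambda>l. l \<noteq> 0) w)})
   = 3 ^ n - 2 * (int n * 2 ^ n - 2 * 2 ^ n + 3 + 2 * int n + int (n choose 2))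
     + 2 ^ n + int ((n + 1) choose 2) + 2 * int ((n - 2) choose 2) + int ((n - 4) choose 2)
     + int (n - 5)"
proof -
  let ?W = "words {0, 1, 2 :: nat} n"
  let ?P = "{w \<in> ?W. near_sorted 0 1 (filter (\<lambda>l. l \<noteq> 2) w)}"
  let ?Q = "{w \<in> ?W. near_sorted 1 2 (filter (\<lambda>l. l \<noteq> 0) w)}"
  let ?N = "\<Sum>k\<le>n. (n choose k) * ((k + 1) + (k - 3))"
  have fin: "finite ?W" by simp
  have "{w \<in> ?W. \<not> near_sorted 0 1 (filter (\<lambda>l. l \<noteq> 2) w) \<and> \<not> near_sorted 1 2 (filter (\<lambda>l. l \<noteq> 0) w)}
      = ?W - (?P \<union> ?Q)" (is "?R = _") by blast
  then have "card ?R = card (?W - (?P \<union> ?Q))" by (rule arg_cong)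
  moreover have "card (?W - (?P \<union> ?Q)) + card (?P \<union> ?Q) = card ?W"
    using fin by (subst card_Un_disjoint[symmetric]) (auto intro!: arg_cong[where f = card])
  moreover have "card ?P + card ?Q = card (?P \<union> ?Q) + card (?P \<inter> ?Q)"
    using fin by (intro card_Un_Int) auto
  moreover have "card ?W = 3 ^ n" by (simp add: card_words numeral_3_eq_3)
  moreover have "card ?P = ?N"
    using card_words_filter[of "{0, 1::nat}" 2 n "near_sorted 0 1"]
    by (simp add: card_near_sorted insert_commute)
  moreover have "card ?Q = ?N"
    using card_words_filter[of "{1, 2::nat}" 0 n "near_sorted 1 2"]
    by (simp add: card_near_sorted insert_commute)
  moreover have "card (?P \<inter> ?Q) = card {w \<in> ?W. doubly_near_sorted w}"
    by (rule arg_cong[where f = card]) (auto simp: doubly_near_sorted_def)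
  ultimately have "card ?R + 2 * ?N = 3 ^ n + card {w \<in> ?W. doubly_near_sorted w}"
    by linarith
  then have "int (card ?R + 2 * ?N) = int (3 ^ n + card {w \<in> ?W. doubly_near_sorted w})"
    by (rule arg_cong)
  then have "int (card ?R) + 2 * int ?N = 3 ^ n + int (card {w \<in> ?W. doubly_near_sorted w})"
    by (simp only: of_nat_add of_nat_mult of_nat_power of_nat_numeral)
  then have "int (card ?R) = 3 ^ n - 2 * int ?N + int (card {w \<in> ?W. doubly_near_sorted w})"
    by (simp only: eq_diff_eq[symmetric] diff_add_eq)
  then show ?thesis
    unfolding sum_choose_near_sorted card_doubly_near_sorted
    by (simp only: of_nat_add of_nat_mult of_nat_power of_nat_numeral add.assoc)
qed

text \<open>
  The subtractions inside \<open>int\<close> are truncated, so that the formula holds for small \<open>n\<close> as well.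
\<close>

lemma d_1324_2_eq:
  "int (d_1324 2 n)
   = 3 ^ n - 2 * (int n * 2 ^ n - 2 * 2 ^ n + 3 + 2 * int n + int (n choose 2))
     + 2 ^ n + int ((n + 1) choose 2) + 2 * int ((n - 2) choose 2) + int ((n - 4) choose 2)
     + int (n - 5)"
  unfolding d_1324_eq_card_words by (rule card_words_neither_near_sorted)

section \<open>The exponential generating function\<close>

lemma fps_X_mult_exp_nth:
  "fps_nth (fps_X * fps_exp c) n = real n * c ^ (n - 1) / fact n"
  by (cases n) (auto simp: divide_simps simp del: of_nat_Suc)

lemma fps_X_sq_mult_exp_nth:
  "fps_nth (fps_X ^ 2 * fps_exp c) n = real n * (real n - 1) * c ^ (n - 2) / fact n"
proof -
  consider "n = 0" | "n = 1" | m where "n = Suc (Suc m)" by (metis One_nat_def not0_implies_Suc)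
  then show ?thesis
   by cases (auto simp: fps_X_power_mult_nth divide_simps simp del: of_nat_Suc)
qed

lemma two_choose_two: "2 * int (k choose 2) = int k * (int k - 1)"
  by (induction k) (auto simp: numeral_2_eq_2 algebra_simps)

theorem mainTheorem4:
  shows "Abs_fps (\<lambda>n. real (d_1324 2 n) / fact n) =
           fps_exp 3 + (5 - 4 * fps_X) * fps_exp 2 + (fps_X ^ 2 - 10 * fps_X + 5) * fps_exp 1
             - 11 - 4 * fps_X + fps_const (1 / 6) * fps_X ^ 3 + fps_const (1 / 24) * fps_X ^ 4
         \<and> (\<forall>n\<ge>5. int (d_1324 2 n) =
               3 ^ n + (5 - 2 * int n) * 2 ^ n + int n ^ 2 - 11 * int n + 5)"
    (is "_ = ?F \<and> _")
proof (intro conjI allI impI fps_ext)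
  show large: "int (d_1324 2 n) = 3 ^ n + (5 - 2 * int n) * 2 ^ n + int n ^ 2 - 11 * int n + 5"
    if "n \<ge> 5" for n
  proof -
    from that obtain m where n: "n = m + 5" by (metis le_add_diff_inverse2)
    have "2 * int (d_1324 2 n) = 2 * (3 ^ n + (5 - 2 * int n) * 2 ^ n + int n ^ 2 - 11 * int n + 5)"
      using two_choose_two[of "m + 5"] two_choose_two[of "m + 6"] two_choose_two[of "m + 3"]
        two_choose_two[of "m + 1"]
      unfolding d_1324_2_eq n by (simp add: algebra_simps power2_eq_square)
    then show ?thesis by simp
  qed
  fix n
  have F: "fps_nth ?F n = (3 ^ n + 5 * 2 ^ n - 4 * (real n * 2 ^ (n - 1)) + real n * (real n - 1)
      - 10 * real n + 5) / fact n - (if n = 0 then 11 else 0) - (if n = 1 then 4 else 0)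
      + (if n = 3 then 1 / 6 else 0) + (if n = 4 then 1 / 24 else 0)"
  proof -
    have expand: "?F = fps_exp 3 + fps_const 5 * fps_exp 2 - fps_const 4 * (fps_X * fps_exp 2)
        + fps_X ^ 2 * fps_exp 1 - fps_const 10 * (fps_X * fps_exp 1) + fps_const 5 * fps_exp 1
        - fps_const 11 - fps_const 4 * fps_X + fps_const (1 / 6) * fps_X ^ 3 + fps_const (1 / 24) * fps_X ^ 4"
      by (simp add: numeral_fps_const algebra_simps)
    show ?thesis unfolding expand
      by (simp add: fps_X_mult_exp_nth fps_X_sq_mult_exp_nth fps_X_power_nth fps_X_nth
        diff_divide_distrib add_divide_distrib del: fps_X_mult_nth)
  qed
  show "fps_nth (Abs_fps (\<lambda>n. real (d_1324 2 n) / fact n)) n = fps_nth ?F n"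
  proof (cases "n \<ge> 5")
    case True
    have "real (d_1324 2 n) = of_int (int (d_1324 2 n))" by simp
    also have "\<dots> = 3 ^ n + (5 - 2 * real n) * 2 ^ n + real n ^ 2 - 11 * real n + 5"
      unfolding large[OF True] by simp
    also have "\<dots> = 3 ^ n + 5 * 2 ^ n - 4 * (real n * 2 ^ (n - 1)) + real n * (real n - 1)
      - 10 * real n + 5"
      using True by (cases n) (auto simp: algebra_simps power2_eq_square)
    finally show ?thesis using True unfolding F by simp
  next
    case False
    then consider "n = 0" | "n = 1" | "n = 2" | "n = 3" | "n = 4" by linarith
    then show ?thesis
    proof cases
      case 1
      then show ?thesis using d_1324_2_eq[of 0] unfolding F by (simp add: choose_two)
    next
      case 2
      then show ?thesis using d_1324_2_eq[of 1] unfolding F by (simp add: choose_two)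
    next
      case 3
      then show ?thesis using d_1324_2_eq[of 2] unfolding F by (simp add: choose_two)
    next
      case 4
      then show ?thesis using d_1324_2_eq[of 3] unfolding F by (simp add: choose_two fact_numeral)
    next
      case 5
      then show ?thesis using d_1324_2_eq[of 4] unfolding F by (simp add: choose_two fact_numeral)
    qed
  qed
qed

end
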